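(* Let $(X,A,m,\alpha,r)$ be a reversible micro-macro system such that $r$ preserves entropy, let $n\ge1$, and let $q\in\mathrm{Prob}(A)$ be constant on the communication classes of the stochastic matrix $[r\alpha^n]$. (a) $\sigma_n(r\alpha^n i)=-\sigma_n(i)$ for all $i\in X$, and thus $|r\alpha^n i|=e^{-n\sigma_n(r\alpha^n i)}|i|$. (b) $\mathrm{w}_n^q(x)=e^{nx}\mathrm{w}_n^q(-x)$ for all $x\in\mathbb{R}$. (c) $\sigma_n^q=\sum_{x\in\mathbb{R}_{>0}}x(1-e^{-nx})\mathrm{w}_n^q(x)\ge0$ (a finite sum). (d) $\sigma_n^q=0$ if and only if $\alpha^n$ preserves entropy on $\bigsqcup_{a\in A,\,q_a\ne0}a$, i.e. $S(\alpha^n i)=S(i)$ for all $i$ in macrostates $a$ with $q_a\neq0$. (e) For the uniform probability $u_a=1/|A|$ on $A$, $\sigma_n^u>0$ if and only if there is a microstate $i$ with $S(\alpha^n i)\ne S(i)$.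
   Context: A micro-macro system $(X,A,m,\alpha)$ consists of finite sets $X$, $A$, a bijection $\alpha:X\to X$ and a surjection $m:X\to A$; identify $a\in A$ with $m^{-1}(a)$, $|a|=|m^{-1}(a)|$, $|i|=|m(i)|$, $S(a)=\ln|a|$, $S(i)=\ln|m(i)|$. It is reversible with reversion $r:X\to X$ if $r^2=\mathrm{id}$ and $\alpha^{-1}=r\alpha r$; $r$ preserves entropy if $S(ri)=S(i)$ for all $i$. For a bijection $\beta:X\to X$, $[\beta]$ is the stochastic matrix on $A$ with $[\beta]_{ab}=|\{i\in a:\beta(i)\in b\}|/|a|$; its communication classes are the classes of the relation "$a$ and $b$ are reachable from each other". $(cq)_i=q_{m(i)}/|m(i)|$. $\sigma_n(i)=\frac1n(S(\alpha^ni)-S(i))$, $\sigma_n^q=\sum_i(cq)_i\sigma_n(i)$, and $\mathrm{w}_n^q(x)=\sum_{i:\sigma_n(i)=x}(cq)_i$ is the distribution of $\sigma_n$ under $cq$. *)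

theory Defs
  imports Complex_Main
begin

locale micro_macro_system =
  fixes X :: "'x set" and A :: "'a set" and m :: "'x \<Rightarrow> 'a" and \<alpha> :: "'x \<Rightarrow> 'x"
  assumes finite_X: "finite X"
    and finite_A: "finite A"
    and bij_\<alpha>: "bij_betw \<alpha> X X"
    and surj_m: "m ` X = A"

locale reversible_micro_macro_system = micro_macro_system +
  fixes r :: "'x \<Rightarrow> 'x"
  assumes r_closed: "r ` X \<subseteq> X"
    and r_involution: "\<forall>i\<in>X. r (r i) = i"
    and r_reversion: "\<forall>i\<in>X. inv_into X \<alpha> i = r (\<alpha> (r i))"

definition block :: "'x set \<Rightarrow> ('x \<Rightarrow> 'a) \<Rightarrow> 'a \<Rightarrow> 'x set" where
  "block X m a = {i \<in> X. m i = a}"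

definition macro_size :: "'x set \<Rightarrow> ('x \<Rightarrow> 'a) \<Rightarrow> 'a \<Rightarrow> real" where
  "macro_size X m a = real (card (block X m a))"

definition micro_size :: "'x set \<Rightarrow> ('x \<Rightarrow> 'a) \<Rightarrow> 'x \<Rightarrow> real" where
  "micro_size X m i = macro_size X m (m i)"

definition entropy :: "'x set \<Rightarrow> ('x \<Rightarrow> 'a) \<Rightarrow> 'x \<Rightarrow> real" where
  "entropy X m i = ln (micro_size X m i)"

definition preserves_entropy_on ::
  "'x set \<Rightarrow> ('x \<Rightarrow> 'a) \<Rightarrow> ('x \<Rightarrow> 'x) \<Rightarrow> 'x set \<Rightarrow> bool" where
  "preserves_entropy_on X m \<beta> Y \<longleftrightarrow> (\<forall>i\<in>Y. entropy X m (\<beta> i) = entropy X m i)"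

definition prob_vectors :: "'a set \<Rightarrow> ('a \<Rightarrow> real) set" where
  "prob_vectors A = {q. (\<forall>a\<in>A. 0 \<le> q a) \<and> (\<Sum>a\<in>A. q a) = 1}"

definition transition_matrix ::
  "'x set \<Rightarrow> ('x \<Rightarrow> 'a) \<Rightarrow> ('x \<Rightarrow> 'x) \<Rightarrow> 'a \<Rightarrow> 'a \<Rightarrow> real" where
  "transition_matrix X m \<beta> a b =
     real (card {i \<in> block X m a. \<beta> i \<in> block X m b}) / macro_size X m a"

text \<open>Reachability allows zero steps, so every state communicates with itself.\<close>

definition reachable :: "'a set \<Rightarrow> ('a \<Rightarrow> 'a \<Rightarrow> real) \<Rightarrow> 'a rel" where
  "reachable A P = {(a, b) \<in> A \<times> A. P a b > 0}\<^sup>*"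

definition communication_classes :: "'a set \<Rightarrow> ('a \<Rightarrow> 'a \<Rightarrow> real) \<Rightarrow> 'a set set" where
  "communication_classes A P =
     A // {(a, b) \<in> A \<times> A. (a, b) \<in> reachable A P \<and> (b, a) \<in> reachable A P}"

definition coarse_lift :: "'x set \<Rightarrow> ('x \<Rightarrow> 'a) \<Rightarrow> ('a \<Rightarrow> real) \<Rightarrow> 'x \<Rightarrow> real" where
  "coarse_lift X m q i = q (m i) / micro_size X m i"

definition entropy_rate ::
  "'x set \<Rightarrow> ('x \<Rightarrow> 'a) \<Rightarrow> ('x \<Rightarrow> 'x) \<Rightarrow> nat \<Rightarrow> 'x \<Rightarrow> real" where
  "entropy_rate X m \<alpha> n i = (1 / real n) * (entropy X m ((\<alpha> ^^ n) i) - entropy X m i)"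

definition mean_entropy_rate ::
  "'x set \<Rightarrow> ('x \<Rightarrow> 'a) \<Rightarrow> ('x \<Rightarrow> 'x) \<Rightarrow> nat \<Rightarrow> ('a \<Rightarrow> real) \<Rightarrow> real" where
  "mean_entropy_rate X m \<alpha> n q =
     (\<Sum>i\<in>X. coarse_lift X m q i * entropy_rate X m \<alpha> n i)"

definition entropy_rate_dist ::
  "'x set \<Rightarrow> ('x \<Rightarrow> 'a) \<Rightarrow> ('x \<Rightarrow> 'x) \<Rightarrow> nat \<Rightarrow> ('a \<Rightarrow> real) \<Rightarrow> real \<Rightarrow> real" where
  "entropy_rate_dist X m \<alpha> n q x =
     (\<Sum>i\<in>{i \<in> X. entropy_rate X m \<alpha> n i = x}. coarse_lift X m q i)"

end

theory Submission
  imports Defs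
begin

text \<open>
  The map \<open>r \<circ> \<alpha>\<^sup>n\<close> is an involution that changes the sign of \<open>\<sigma>\<^sub>n\<close>. It moves each microstate
  to a communicating macrostate, where \<open>q\<close> has the same value, so it multiplies the weight \<open>(cq)\<^sub>i\<close>
  by \<open>exp (- n \<sigma>\<^sub>n(i))\<close>. Summing over the microstates with \<open>\<sigma>\<^sub>n(i) = x\<close> gives the relation
  \<open>w(x) = exp (n x) w(-x)\<close>, and everything else is a property of this relation: pairing \<open>x\<close> with
  \<open>-x\<close> in \<open>\<Sum>x. x w(x)\<close> leaves a sum of nonnegative terms, whose vanishing confines \<open>w\<close> to \<open>0\<close>.
\<close>

definition law :: "'x set \<Rightarrow> ('x \<Rightarrow> 'w::comm_monoid_add) \<Rightarrow> ('x \<Rightarrow> 'y) \<Rightarrow> 'y \<Rightarrow> 'w" where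
  "law X p f x = (\<Sum>i | i \<in> X \<and> f i = x. p i)"

definition first_moment :: "(real \<Rightarrow> real) \<Rightarrow> real" where
  "first_moment w = (\<Sum>x | w x \<noteq> 0. x * w x)"

lemma support_law: "{x. law X p f x \<noteq> 0} \<subseteq> f ` X"
  unfolding law_def by (auto elim: sum.not_neutral_contains_not_neutral)

lemma law_nonneg:
  fixes p :: "'x \<Rightarrow> 'w::ordered_comm_monoid_add"
  shows "(\<And>i. i \<in> X \<Longrightarrow> 0 \<le> p i) \<Longrightarrow> 0 \<le> law X p f x"
  unfolding law_def by (rule sum_nonneg) simp

lemma law_eq_0_iff:
  fixes p :: "'x \<Rightarrow> 'w::ordered_comm_monoid_add"
  assumes "finite X" "\<And>i. i \<in> X \<Longrightarrow> 0 \<le> p i"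
  shows "law X p f x = 0 \<longleftrightarrow> (\<forall>i\<in>X. f i = x \<longrightarrow> p i = 0)"
  unfolding law_def using assms by (subst sum_nonneg_eq_0_iff) auto

lemma first_moment_law:
  assumes "finite X"
  shows "first_moment (law X p f) = (\<Sum>i\<in>X. p i * f i)"
proof -
  have "(\<Sum>i\<in>X. p i * f i) = (\<Sum>x\<in>f ` X. \<Sum>i | i \<in> X \<and> f i = x. p i * f i)"
    by (rule sum.image_gen[OF assms])
  also have "\<dots> = (\<Sum>x\<in>f ` X. x * law X p f x)"
    by (auto simp: law_def sum_distrib_left mult.commute intro!: sum.cong)
  also have "\<dots> = first_moment (law X p f)"
    unfolding first_moment_def using assms support_law[of X p f] by (intro sum.mono_neutral_right) auto
  finally show ?thesis ..
qed

lemma law_fluctuation_relation: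
  fixes p f :: "'x \<Rightarrow> real"
  assumes bij: "bij_betw \<tau> X X"
    and odd: "\<And>i. i \<in> X \<Longrightarrow> f (\<tau> i) = - f i"
    and weight: "\<And>i. i \<in> X \<Longrightarrow> p (\<tau> i) = exp (- (c * f i)) * p i"
  shows "law X p f x = exp (c * x) * law X p f (- x)"
proof -
  have "bij_betw \<tau> {i \<in> X. f i = x} {i \<in> X. f i = - x}"
    by (rule bij_betw_Collect[OF bij]) (simp add: odd)
  then have "law X p f (- x) = (\<Sum>i | i \<in> X \<and> f i = x. p (\<tau> i))"
    unfolding law_def by (rule sum.reindex_bij_betw[symmetric])
  also have "\<dots> = exp (- (c * x)) * law X p f x"
    unfolding law_def sum_distrib_left by (rule sum.cong) (auto simp: weight)
  finally show ?thesis
    by (simp add: exp_minus)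
qed

locale fluctuation_relation =
  fixes w :: "real \<Rightarrow> real" and c :: real
  assumes finite_support: "finite {x. w x \<noteq> 0}"
    and symmetry: "w x = exp (c * x) * w (- x)"
begin

lemma uminus: "w (- x) = exp (- (c * x)) * w x"
  using symmetry[of "- x"] by simp

lemma finite_pos_support: "finite {x. 0 < x \<and> w x \<noteq> 0}"
  by (rule finite_subset[OF _ finite_support]) blast

lemma first_moment_eq_sum_pos:
  "first_moment w = (\<Sum>x | 0 < x \<and> w x \<noteq> 0. x * (1 - exp (- (c * x))) * w x)"
proof -
  let ?P = "{x. 0 < x \<and> w x \<noteq> 0}" and ?N = "{x. x < 0 \<and> w x \<noteq> 0}"
  have "finite ?N"
    by (rule finite_subset[OF _ finite_support]) blast
  moreover have "first_moment w = (\<Sum>x\<in>?P \<union> ?N. x * w x)"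
    unfolding first_moment_def using finite_support by (intro sum.mono_neutral_right) auto
  ultimately have "first_moment w = (\<Sum>x\<in>?P. x * w x) + (\<Sum>x\<in>?N. x * w x)"
    using finite_pos_support by (simp add: sum.union_disjoint disjoint_iff)
  also have "(\<Sum>x\<in>?N. x * w x) = (\<Sum>x\<in>?P. - x * w (- x))"
    by (rule sum.reindex_bij_witness[where i = uminus and j = uminus]) (auto simp: uminus)
  also have "(\<Sum>x\<in>?P. x * w x) + \<dots> = (\<Sum>x\<in>?P. x * (1 - exp (- (c * x))) * w x)"
    by (simp add: uminus algebra_simps flip: sum.distrib)
  finally show ?thesis .
qed

lemma first_moment_nonneg:
  assumes "c \<ge> 0" "\<And>x. 0 \<le> w x"
  shows "first_moment w \<ge> 0"
  unfolding first_moment_eq_sum_pos using assms by (auto intro!: sum_nonneg mult_nonneg_nonneg)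

lemma first_moment_eq_0_iff:
  assumes "c > 0" "\<And>x. 0 \<le> w x"
  shows "first_moment w = 0 \<longleftrightarrow> (\<forall>x. x \<noteq> 0 \<longrightarrow> w x = 0)"
proof
  assume "first_moment w = 0"
  moreover have "0 \<le> x * (1 - exp (- (c * x))) * w x" if "0 < x" for x
    using assms that by (auto intro!: mult_nonneg_nonneg)
  ultimately have "\<forall>x\<in>{x. 0 < x \<and> w x \<noteq> 0}. x * (1 - exp (- (c * x))) * w x = 0"
    unfolding first_moment_eq_sum_pos
    by (subst (asm) sum_nonneg_eq_0_iff) (auto simp: finite_pos_support)
  then have pos: "w x = 0" if "0 < x" for x
    using assms(1) that by auto
  show "\<forall>x. x \<noteq> 0 \<longrightarrow> w x = 0"
  proof (intro allI impI)
    fix x :: real assume "x \<noteq> 0"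
    then consider "0 < x" | "0 < - x" by linarith
    then show "w x = 0"
      using pos uminus[of "- x"] by cases auto
  qed
qed (auto simp: first_moment_def intro!: sum.neutral)

end

lemma entropy_rate_dist_eq_law:
  "entropy_rate_dist X m \<alpha> n q = law X (coarse_lift X m q) (entropy_rate X m \<alpha> n)"
  by (simp add: fun_eq_iff entropy_rate_dist_def law_def)

lemma communication_class_if_reachable:
  assumes "a \<in> A" "b \<in> A" "(a, b) \<in> reachable A P" "(b, a) \<in> reachable A P"
  obtains C where "C \<in> communication_classes A P" "a \<in> C" "b \<in> C"
proof (rule that)
  let ?R = "{(a, b) \<in> A \<times> A. (a, b) \<in> reachable A P \<and> (b, a) \<in> reachable A P}"
  show "?R `` {a} \<in> communication_classes A P"
    unfolding communication_classes_def using assms(1) by (rule quotientI)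
  have "(a, a) \<in> reachable A P"
    by (simp add: reachable_def)
  then show "a \<in> ?R `` {a}" "b \<in> ?R `` {a}"
    using assms by simp_all
qed

context micro_macro_system
begin

lemma funpow_closed: "i \<in> X \<Longrightarrow> (\<alpha> ^^ n) i \<in> X"
  by (rule bij_betw_apply[OF bij_betw_funpow[OF bij_\<alpha>]])

lemma micro_size_pos: "i \<in> X \<Longrightarrow> micro_size X m i > 0"
  using finite_X by (auto simp: micro_size_def macro_size_def block_def card_gt_0_iff)

lemma first_moment_entropy_rate_dist:
  "first_moment (entropy_rate_dist X m \<alpha> n q) = mean_entropy_rate X m \<alpha> n q"
  by (simp add: entropy_rate_dist_eq_law first_moment_law finite_X mean_entropy_rate_def)

lemma micro_size_ratio:
  assumes "i \<in> X" "j \<in> X"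
  shows "micro_size X m j = exp (entropy X m j - entropy X m i) * micro_size X m i"
  using assms by (simp add: entropy_def exp_diff micro_size_pos less_imp_neq[symmetric])

lemma coarse_lift_ratio:
  assumes "i \<in> X" "j \<in> X" "q (m j) = q (m i)"
  shows "coarse_lift X m q j = exp (- (entropy X m j - entropy X m i)) * coarse_lift X m q i"
  using assms micro_size_pos[of i]
  by (simp add: coarse_lift_def micro_size_ratio[of i j] exp_diff)

lemma coarse_lift_nonneg:
  assumes "\<And>a. a \<in> A \<Longrightarrow> 0 \<le> q a" "i \<in> X"
  shows "0 \<le> coarse_lift X m q i"
  using assms surj_m micro_size_pos[of i] by (auto simp: coarse_lift_def)

lemma coarse_lift_eq_0_iff: "i \<in> X \<Longrightarrow> coarse_lift X m q i = 0 \<longleftrightarrow> q (m i) = 0"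
  using micro_size_pos[of i] by (simp add: coarse_lift_def)

lemma Union_block_eq: "(\<Union>a\<in>{a \<in> A. Q a}. block X m a) = {i \<in> X. Q (m i)}"
  using surj_m by (auto simp: block_def)

lemma transition_matrix_pos:
  assumes "i \<in> X" "\<beta> i \<in> X"
  shows "transition_matrix X m \<beta> (m i) (m (\<beta> i)) > 0"
proof -
  have "card {j \<in> block X m (m i). \<beta> j \<in> block X m (m (\<beta> i))} > 0"
    using assms finite_X by (auto simp: block_def card_gt_0_iff)
  then show ?thesis
    using micro_size_pos[OF assms(1)] by (simp add: transition_matrix_def micro_size_def)
qed

lemma reachable_transition_matrix:
  assumes "i \<in> X" "\<beta> i \<in> X"
  shows "(m i, m (\<beta> i)) \<in> reachable A (transition_matrix X m \<beta>)"
  unfolding reachable_def using assms surj_m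
  by (auto simp: transition_matrix_pos intro!: r_into_rtrancl)

lemma communication_class_involution:
  assumes "i \<in> X" "\<beta> i \<in> X" "\<beta> (\<beta> i) = i"
  obtains C where "C \<in> communication_classes A (transition_matrix X m \<beta>)"
    "m i \<in> C" "m (\<beta> i) \<in> C"
proof (rule communication_class_if_reachable)
  show "m i \<in> A" "m (\<beta> i) \<in> A"
    using assms surj_m by auto
  show "(m i, m (\<beta> i)) \<in> reachable A (transition_matrix X m \<beta>)"
    using assms by (intro reachable_transition_matrix)
  show "(m (\<beta> i), m i) \<in> reachable A (transition_matrix X m \<beta>)"
    using reachable_transition_matrix[of "\<beta> i" \<beta>] assms by simp
qed

lemma entropy_rate_mult:
  "real n * entropy_rate X m \<alpha> n i = entropy X m ((\<alpha> ^^ n) i) - entropy X m i"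
  by (cases "n = 0") (simp_all add: entropy_rate_def)

end

context reversible_micro_macro_system
begin

lemma r_in: "i \<in> X \<Longrightarrow> r i \<in> X"
  using r_closed by auto

lemma \<alpha>_r_\<alpha>:
  assumes "i \<in> X"
  shows "\<alpha> (r (\<alpha> i)) = r i"
proof -
  have X: "\<alpha> i \<in> X" "\<alpha> (r (\<alpha> i)) \<in> X"
    using assms bij_betwE[OF bij_\<alpha>] r_in by auto
  have "i = inv_into X \<alpha> (\<alpha> i)"
    using assms bij_\<alpha> by (simp add: bij_betw_def)
  also have "\<dots> = r (\<alpha> (r (\<alpha> i)))"
    using r_reversion X by auto
  finally show ?thesis
    using r_involution X by metis
qed

lemma funpow_r_funpow: "i \<in> X \<Longrightarrow> (\<alpha> ^^ n) (r ((\<alpha> ^^ n) i)) = r i"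
proof (induction n)
  case (Suc n)
  have "(\<alpha> ^^ Suc n) (r ((\<alpha> ^^ Suc n) i)) = (\<alpha> ^^ n) (\<alpha> (r (\<alpha> ((\<alpha> ^^ n) i))))"
    by (simp add: funpow_swap1)
  then show ?case
    using Suc by (simp add: \<alpha>_r_\<alpha> funpow_closed)
qed simp

end

locale entropy_preserving_reversal = reversible_micro_macro_system +
  assumes r_entropy: "preserves_entropy_on X m r X"
begin

lemma entropy_r_funpow: "i \<in> X \<Longrightarrow> entropy X m (r ((\<alpha> ^^ n) i)) = entropy X m ((\<alpha> ^^ n) i)"
  using r_entropy by (simp add: preserves_entropy_on_def funpow_closed)

lemma entropy_rate_r_funpow:
  assumes "i \<in> X"
  shows "entropy_rate X m \<alpha> n (r ((\<alpha> ^^ n) i)) = - entropy_rate X m \<alpha> n i"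
proof -
  have "entropy X m ((\<alpha> ^^ n) (r ((\<alpha> ^^ n) i))) = entropy X m i"
    using assms r_entropy by (simp add: funpow_r_funpow preserves_entropy_on_def)
  then show ?thesis
    using assms by (simp add: entropy_rate_def entropy_r_funpow algebra_simps)
qed

lemma micro_size_r_funpow:
  assumes "i \<in> X"
  shows "micro_size X m (r ((\<alpha> ^^ n) i)) =
    exp (real n * entropy_rate X m \<alpha> n i) * micro_size X m i"
  using assms micro_size_ratio[of i "r ((\<alpha> ^^ n) i)"]
  by (simp add: entropy_rate_mult entropy_r_funpow r_in funpow_closed)

end

locale communication_invariant_weight = entropy_preserving_reversal +
  fixes n :: nat and q :: "'b \<Rightarrow> real"
  assumes q_nonneg: "a \<in> A \<Longrightarrow> 0 \<le> q a"
    and q_communicating: "C \<in> communication_classes A (transition_matrix X m (r \<circ> (\<alpha> ^^ n))) \<Longrightarrow>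
      a \<in> C \<Longrightarrow> b \<in> C \<Longrightarrow> q a = q b"
begin

abbreviation \<tau> :: "'a \<Rightarrow> 'a" where
  "\<tau> \<equiv> r \<circ> (\<alpha> ^^ n)"

lemma \<tau>_in: "i \<in> X \<Longrightarrow> \<tau> i \<in> X"
  by (simp add: r_in funpow_closed)

lemma \<tau>_involution: "i \<in> X \<Longrightarrow> \<tau> (\<tau> i) = i"
  using r_involution by (simp add: funpow_r_funpow)

lemma bij_betw_\<tau>: "bij_betw \<tau> X X"
  by (rule bij_betw_byWitness[where f' = \<tau>]) (use \<tau>_in \<tau>_involution in auto)

lemma q_\<tau>:
  assumes "i \<in> X"
  shows "q (m (\<tau> i)) = q (m i)"
  using communication_class_involution[OF assms \<tau>_in[OF assms] \<tau>_involution[OF assms]]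
    q_communicating by metis

lemma coarse_lift_\<tau>:
  assumes "i \<in> X"
  shows "coarse_lift X m q (\<tau> i) =
    exp (- (real n * entropy_rate X m \<alpha> n i)) * coarse_lift X m q i"
  using coarse_lift_ratio[of i "\<tau> i" q] assms q_\<tau>[OF assms] \<tau>_in[OF assms]
  by (simp add: entropy_rate_mult entropy_r_funpow)

sublocale fluctuation_relation "entropy_rate_dist X m \<alpha> n q" "real n"
proof
  show "finite {x. entropy_rate_dist X m \<alpha> n q x \<noteq> 0}"
    unfolding entropy_rate_dist_eq_law
    by (rule finite_subset[OF support_law]) (simp add: finite_X)
  show "entropy_rate_dist X m \<alpha> n q x =
      exp (real n * x) * entropy_rate_dist X m \<alpha> n q (- x)" for x
    unfolding entropy_rate_dist_eq_law
    by (rule law_fluctuation_relation[where \<tau> = \<tau>])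
      (fact bij_betw_\<tau> coarse_lift_\<tau> | simp add: entropy_rate_r_funpow)+
qed

lemma entropy_rate_dist_nonneg: "0 \<le> entropy_rate_dist X m \<alpha> n q x"
  unfolding entropy_rate_dist_eq_law by (intro law_nonneg coarse_lift_nonneg q_nonneg)

lemma mean_entropy_rate_eq_sum_pos:
  "mean_entropy_rate X m \<alpha> n q =
     (\<Sum>x | 0 < x \<and> entropy_rate_dist X m \<alpha> n q x \<noteq> 0.
        x * (1 - exp (- (real n * x))) * entropy_rate_dist X m \<alpha> n q x)"
  using first_moment_eq_sum_pos by (simp only: first_moment_entropy_rate_dist)

lemma mean_entropy_rate_nonneg: "0 \<le> mean_entropy_rate X m \<alpha> n q"
  using first_moment_nonneg[OF _ entropy_rate_dist_nonneg]
  by (simp add: first_moment_entropy_rate_dist)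

lemma mean_entropy_rate_eq_0_iff:
  assumes "n \<ge> 1"
  shows "mean_entropy_rate X m \<alpha> n q = 0
    \<longleftrightarrow> preserves_entropy_on X m (\<alpha> ^^ n) {i \<in> X. q (m i) \<noteq> 0}"
proof -
  have "mean_entropy_rate X m \<alpha> n q = 0 \<longleftrightarrow> (\<forall>x. x \<noteq> 0 \<longrightarrow> entropy_rate_dist X m \<alpha> n q x = 0)"
    using first_moment_eq_0_iff[OF _ entropy_rate_dist_nonneg] assms
    by (simp add: first_moment_entropy_rate_dist)
  also have "\<dots> \<longleftrightarrow> (\<forall>i\<in>X. entropy_rate X m \<alpha> n i \<noteq> 0 \<longrightarrow> coarse_lift X m q i = 0)"
    by (auto simp: entropy_rate_dist_eq_law law_eq_0_iff finite_X coarse_lift_nonneg q_nonneg)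
  also have "\<dots> \<longleftrightarrow> preserves_entropy_on X m (\<alpha> ^^ n) {i \<in> X. q (m i) \<noteq> 0}"
    using assms
    by (auto simp: coarse_lift_eq_0_iff entropy_rate_def preserves_entropy_on_def)
  finally show ?thesis .
qed

end

theorem theorem24:
  fixes X :: "'x set" and A :: "'a set" and m :: "'x \<Rightarrow> 'a"
    and \<alpha> r :: "'x \<Rightarrow> 'x" and n :: nat and q :: "'a \<Rightarrow> real"
  assumes "reversible_micro_macro_system X A m \<alpha> r"
    and "preserves_entropy_on X m r X"
    and "n \<ge> 1"
    and "q \<in> prob_vectors A"
    and "\<forall>C \<in> communication_classes A (transition_matrix X m (r \<circ> (\<alpha> ^^ n))).
           \<forall>a\<in>C. \<forall>b\<in>C. q a = q b"
  shows "(\<forall>i\<in>X. entropy_rate X m \<alpha> n (r ((\<alpha> ^^ n) i)) = - entropy_rate X m \<alpha> n i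
           \<and> micro_size X m (r ((\<alpha> ^^ n) i))
             = exp (- real n * entropy_rate X m \<alpha> n (r ((\<alpha> ^^ n) i))) * micro_size X m i)
    \<and> (\<forall>x. entropy_rate_dist X m \<alpha> n q x
           = exp (real n * x) * entropy_rate_dist X m \<alpha> n q (- x))
    \<and> (finite {x. 0 < x \<and> entropy_rate_dist X m \<alpha> n q x \<noteq> 0}
       \<and> mean_entropy_rate X m \<alpha> n q
           = (\<Sum>x\<in>{x. 0 < x \<and> entropy_rate_dist X m \<alpha> n q x \<noteq> 0}.
                x * (1 - exp (- real n * x)) * entropy_rate_dist X m \<alpha> n q x)
       \<and> mean_entropy_rate X m \<alpha> n q \<ge> 0)
    \<and> (mean_entropy_rate X m \<alpha> n q = 0
         \<longleftrightarrow> preserves_entropy_on X m (\<alpha> ^^ n) (\<Union>a\<in>{a \<in> A. q a \<noteq> 0}. block X m a))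
    \<and> (mean_entropy_rate X m \<alpha> n (\<lambda>a. 1 / real (card A)) > 0
         \<longleftrightarrow> (\<exists>i\<in>X. entropy X m ((\<alpha> ^^ n) i) \<noteq> entropy X m i))"
proof -
  interpret entropy_preserving_reversal X A m \<alpha> r
    using assms(1,2)
    by (simp add: entropy_preserving_reversal_def entropy_preserving_reversal_axioms_def)
  interpret q: communication_invariant_weight X A m \<alpha> r n q
    by unfold_locales (use assms(4,5) in \<open>simp add: prob_vectors_def, blast\<close>)
  interpret u: communication_invariant_weight X A m \<alpha> r n "\<lambda>a. 1 / real (card A)"
    by unfold_locales auto
  have "A \<noteq> {}"
    using assms(4) by (auto simp: prob_vectors_def)
  then have uniform: "mean_entropy_rate X m \<alpha> n (\<lambda>a. 1 / real (card A)) > 0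
      \<longleftrightarrow> (\<exists>i\<in>X. entropy X m ((\<alpha> ^^ n) i) \<noteq> entropy X m i)"
    using u.mean_entropy_rate_eq_0_iff[OF assms(3)] u.mean_entropy_rate_nonneg finite_A
    by (simp add: preserves_entropy_on_def less_le)
  show ?thesis
    unfolding Union_block_eq mult_minus_left
  proof (intro conjI ballI allI)
    show "entropy_rate X m \<alpha> n (r ((\<alpha> ^^ n) i)) = - entropy_rate X m \<alpha> n i"
      and "micro_size X m (r ((\<alpha> ^^ n) i)) =
        exp (- (real n * entropy_rate X m \<alpha> n (r ((\<alpha> ^^ n) i)))) * micro_size X m i"
      if "i \<in> X" for i
      using that by (simp_all add: entropy_rate_r_funpow micro_size_r_funpow)
  qed (fact q.symmetry q.finite_pos_support q.mean_entropy_rate_eq_sum_pos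
      q.mean_entropy_rate_nonneg q.mean_entropy_rate_eq_0_iff[OF assms(3)] uniform)+
qed

end
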